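(* Let $L$ be a complete, meet-continuous modular lattice, and $x\prec y$ a covering in $L$. Let \[b_1\succ a_1\ge b_2\succ a_2\ge\cdots\ge b_n\succ a_n\] be elements of $L$ such that $\langle x,y\rangle\sim\langle a_i,b_i\rangle$ for all $i$. If $\bar C$ is a maximal chain in $\mathrm{Fil}\,L$, then $\mu_{\bar C}[\mathrm{Fg}\{x\}\prec\mathrm{Fg}\{y\}]\ge\Lambda(n)$.
   Context: The function $\Lambda:\mathbb N\to\mathbb N$ is defined recursively by $\Lambda(0)=0$ and $\Lambda(n)=1+\Lambda(\lfloor\sqrt n\rfloor-1)$ for $n>0$. A covering $x\prec y$ in a lattice is a pair $x<y$ with no element strictly between ($y\succ x$ means the same). For pairs with $x\le y$, $z\le w$, write $\langle x,y\rangle\nearrow\langle z,w\rangle$ if $y\wedge z=x$ and $y\vee z=w$; projective equivalence $\sim$ is the symmetric and transitive closure of $\nearrow$. A complete lattice $L$ is meet-continuous if $a\wedge\bigvee D=\bigvee_{d\in D}(a\wedge d)$ for all $a\in L$ and all upward directed $D\subseteq L$. For a chain $C$ in a modular lattice $M$ and a covering $x\prec y$ of $M$, $\mu_C[x\prec y]$ is the cardinality of the set of coverings $u\prec v$ of $M$ with $u,v\in C$ and $\langle u,v\rangle\sim\langle x,y\rangle$. A filter of $L$ is a nonempty up-closed subset closed under binary meets. $\mathrm{Fil}\,L$ is the lattice of filters ordered by reverse inclusion ($F\le G$ iff $G\subseteq F$); it is complete and modular when $L$ is. $\mathrm{Fg}\{x\}=\{z\in L: z\ge x\}$; for $L$ modular,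 $x\prec y$ implies $\mathrm{Fg}\{x\}\prec\mathrm{Fg}\{y\}$ in $\mathrm{Fil}\,L$. *)

theory Defs
  imports Main "HOL-Library.Discrete_Functions"
begin

unbundle lattice_syntax and cardinal_syntax

function Lambda :: "nat \<Rightarrow> nat"  (\<open>\<Lambda>\<close>) where
  "\<Lambda> 0 = 0"
| "\<Lambda> (Suc m) = 1 + \<Lambda> (floor_sqrt (Suc m) - 1)"
  by pat_completeness auto
termination
proof (relation "measure id")
  show "(floor_sqrt (Suc m) - 1, Suc m) \<in> measure id" for m
    using floor_sqrt_le[of "Suc m"] by simp
qed simp

class modular_lattice = lattice +
  assumes modular_law: "x \<le> z \<Longrightarrow> x \<squnion> (y \<sqinter> z) = (x \<squnion> y) \<sqinter> z"

definition (in order) up_directed :: "'a set \<Rightarrow> bool" where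
  "up_directed D \<longleftrightarrow> D \<noteq> {} \<and> (\<forall>u\<in>D. \<forall>v\<in>D. \<exists>w\<in>D. u \<le> w \<and> v \<le> w)"

class meet_continuous_lattice = complete_lattice +
  assumes meet_continuous: "up_directed D \<Longrightarrow> a \<sqinter> \<Squnion>D = (\<Squnion>d\<in>D. a \<sqinter> d)"

definition covering :: "'a::order \<Rightarrow> 'a \<Rightarrow> bool"  (infix \<open>\<prec>\<close> 50) where
  "x \<prec> y \<longleftrightarrow> x < y \<and> \<not> (\<exists>z. x < z \<and> z < y)"

fun perspective_up :: "'a::lattice \<times> 'a \<Rightarrow> 'a \<times> 'a \<Rightarrow> bool"  (infix \<open>\<nearrow>\<close> 50) where
  "(x, y) \<nearrow> (z, w) \<longleftrightarrow> x \<le> y \<and> z \<le> w \<and> y \<sqinter> z = x \<and> y \<squnion> z = w"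

definition projective :: "'a::lattice \<times> 'a \<Rightarrow> 'a \<times> 'a \<Rightarrow> bool"  (infix \<open>\<sim>\<close> 50) where
  "(\<sim>) = (symclp (\<nearrow>))\<^sup>+\<^sup>+"

text \<open>The multiplicity is a genuine cardinal (possibly infinite), in the sense of \<^const>\<open>card_of\<close>.\<close>

definition multiplicity_in :: "'a::lattice set \<Rightarrow> 'a \<Rightarrow> 'a \<Rightarrow> ('a \<times> 'a) rel"  (\<open>\<mu>\<close>) where
  "\<mu> C x y = |{(u, v). u \<in> C \<and> v \<in> C \<and> u \<prec> v \<and> (u, v) \<sim> (x, y)}|"

definition is_lattice_filter :: "'a::lattice set \<Rightarrow> bool" where
  "is_lattice_filter F \<longleftrightarrow> F \<noteq> {} \<and> (\<forall>u\<in>F. \<forall>v. u \<le> v \<longrightarrow> v \<in> F) \<and> (\<forall>u\<in>F. \<forall>v\<in>F. u \<sqinter> v \<in> F)"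

lemma is_lattice_filter_nonempty: "is_lattice_filter F \<Longrightarrow> \<exists>u. u \<in> F"
  unfolding is_lattice_filter_def by (elim conjE) (simp add: ex_in_conv)

lemma is_lattice_filter_upward: "is_lattice_filter F \<Longrightarrow> u \<in> F \<Longrightarrow> u \<le> v \<Longrightarrow> v \<in> F"
  unfolding is_lattice_filter_def by metis

lemma is_lattice_filter_inf: "is_lattice_filter F \<Longrightarrow> u \<in> F \<Longrightarrow> v \<in> F \<Longrightarrow> u \<sqinter> v \<in> F"
  unfolding is_lattice_filter_def by metis

lemma is_lattice_filterI:
  assumes "u \<in> F"
    and "\<And>u v. u \<in> F \<Longrightarrow> u \<le> v \<Longrightarrow> v \<in> F"
    and "\<And>u v. u \<in> F \<Longrightarrow> v \<in> F \<Longrightarrow> u \<sqinter> v \<in> F"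
  shows "is_lattice_filter F"
  unfolding is_lattice_filter_def using assms by (metis empty_iff)

lemma is_lattice_filter_Int:
  assumes F: "is_lattice_filter F" and G: "is_lattice_filter G"
  shows "is_lattice_filter (F \<inter> G)"
proof -
  obtain f g where fg: "f \<in> F" "g \<in> G"
    using is_lattice_filter_nonempty[OF F] is_lattice_filter_nonempty[OF G] by auto
  have "f \<squnion> g \<in> F \<inter> G"
    using is_lattice_filter_upward[OF F fg(1) sup_ge1] is_lattice_filter_upward[OF G fg(2) sup_ge2] by simp
  then show ?thesis
    by (rule is_lattice_filterI)
      (simp_all add: is_lattice_filter_inf[OF F] is_lattice_filter_inf[OF G],
       metis is_lattice_filter_upward[OF F] is_lattice_filter_upward[OF G])
qed

lemma is_lattice_filter_generated:
  assumes F: "is_lattice_filter F" and G: "is_lattice_filter G"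
  shows "is_lattice_filter {z. \<exists>f\<in>F. \<exists>g\<in>G. f \<sqinter> g \<le> z}" (is "is_lattice_filter ?M")
proof -
  obtain f g where "f \<in> F" "g \<in> G"
    using is_lattice_filter_nonempty[OF F] is_lattice_filter_nonempty[OF G] by auto
  then have "f \<sqinter> g \<in> ?M"
    unfolding mem_Collect_eq by (metis order_refl)
  then show ?thesis
  proof (rule is_lattice_filterI)
    show "v \<in> ?M" if "u \<in> ?M" "u \<le> v" for u v
      using that by (auto intro: order_trans)
    show "u \<sqinter> v \<in> ?M" if uv: "u \<in> ?M" "v \<in> ?M" for u v
    proof -
      from uv obtain f g f' g' where *: "f \<in> F" "g \<in> G" "f' \<in> F" "g' \<in> G"
        and le: "f \<sqinter> g \<le> u" "f' \<sqinter> g' \<le> v" by auto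
      have "(f \<sqinter> f') \<sqinter> (g \<sqinter> g') = (f \<sqinter> g) \<sqinter> (f' \<sqinter> g')"
        by (simp add: inf.assoc inf.left_commute)
      also have "\<dots> \<le> u \<sqinter> v" using le by (rule inf_mono)
      finally show ?thesis
        using is_lattice_filter_inf[OF F *(1,3)] is_lattice_filter_inf[OF G *(2,4)] by auto
    qed
  qed
qed

typedef (overloaded) 'a lattice_filter = "{F :: 'a::lattice set. is_lattice_filter F}"
  morphisms elements Abs_lattice_filter
  by (rule exI[of _ UNIV]) (simp add: is_lattice_filter_def)

setup_lifting type_definition_lattice_filter

lemma is_lattice_filter_elements: "is_lattice_filter (elements F)"
  using elements by auto

text \<open>Filters are ordered by reverse inclusion, so the join of two filters is their
  intersection and their meet is the filter generated by their union.\<close>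

instantiation lattice_filter :: (lattice) lattice
begin

lift_definition less_eq_lattice_filter :: "'a lattice_filter \<Rightarrow> 'a lattice_filter \<Rightarrow> bool"
  is "\<lambda>F G. G \<subseteq> F" .

lift_definition less_lattice_filter :: "'a lattice_filter \<Rightarrow> 'a lattice_filter \<Rightarrow> bool"
  is "\<lambda>F G. G \<subset> F" .

lift_definition sup_lattice_filter :: "'a lattice_filter \<Rightarrow> 'a lattice_filter \<Rightarrow> 'a lattice_filter"
  is "(\<inter>)"
  by (rule is_lattice_filter_Int)

lift_definition inf_lattice_filter :: "'a lattice_filter \<Rightarrow> 'a lattice_filter \<Rightarrow> 'a lattice_filter"
  is "\<lambda>F G. {z. \<exists>f\<in>F. \<exists>g\<in>G. f \<sqinter> g \<le> z}"
  by (rule is_lattice_filter_generated)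

instance
proof
  fix F G H :: "'a lattice_filter"
  note rep = less_eq_lattice_filter.rep_eq less_lattice_filter.rep_eq
    sup_lattice_filter.rep_eq inf_lattice_filter.rep_eq
  show "(F < G) = (F \<le> G \<and> \<not> G \<le> F)" by (auto simp: rep)
  show "F \<le> F" by (simp add: rep)
  show "F \<le> G \<Longrightarrow> G \<le> H \<Longrightarrow> F \<le> H" by (auto simp: rep)
  show "F \<le> G \<Longrightarrow> G \<le> F \<Longrightarrow> F = G" by (simp add: rep elements_inject[symmetric])
  show "F \<le> F \<squnion> G" "G \<le> F \<squnion> G" by (simp_all add: rep)
  show "G \<le> F \<Longrightarrow> H \<le> F \<Longrightarrow> G \<squnion> H \<le> F" by (simp add: rep)
  obtain f g where fg: "f \<in> elements F" "g \<in> elements G"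
    using is_lattice_filter_nonempty[OF is_lattice_filter_elements] by metis
  show "F \<sqinter> G \<le> F" using fg(2) by (auto simp: rep intro: inf_le1)
  show "F \<sqinter> G \<le> G" using fg(1) by (auto simp: rep intro: inf_le2)
  show "F \<le> G \<Longrightarrow> F \<le> H \<Longrightarrow> F \<le> G \<sqinter> H"
    unfolding rep using is_lattice_filter_upward[OF is_lattice_filter_elements] is_lattice_filter_inf[OF is_lattice_filter_elements]
    by (smt (verit) mem_Collect_eq subset_iff)
qed

end

lift_definition Fg :: "'a::lattice \<Rightarrow> 'a lattice_filter" is "\<lambda>x. {z. x \<le> z}"
  by (rule is_lattice_filterI) (auto intro: order_trans)

end

theory Submission
  imports Defs
begin

text \<open>
  By meet-continuity every \<open>a i\<close> extends to an element \<open>p i\<close> maximal with \<open>p i \<sqinter> b i \<le> a i\<close>;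
  then \<open>q i = p i \<squnion> b i\<close> is the least element strictly above \<open>p i\<close>. For such a pair the largest
  \<open>u \<in> C\<close> below \<open>Fg (p i)\<close> has a successor \<open>v\<close> in \<open>C\<close>, and \<open>(u, v) \<nearrow> (Fg (p i), Fg (q i))\<close>.

  If the resulting coverings \<open>(u, v)\<close> are few, about \<open>\<surd>n\<close> of the indices share the same \<open>(u, v)\<close>.
  Then some \<open>g\<close> in the filter \<open>v\<close> satisfies \<open>g \<sqinter> p i \<le> p j\<close> for all these indices, and joining
  with \<open>g\<close> the chain of partial meets of the \<open>p i\<close> loses only its first covering. This leaves
  \<open>\<surd>n - 1\<close> coverings above \<open>g\<close>. By induction they yield coverings of \<open>C\<close> that are not collapsed by
  joining with \<open>g\<close>, whereas \<open>(u, v)\<close> is.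
\<close>

section \<open>Projectivity and the embedding of a lattice into its filters\<close>

lemma projective_sym: "s \<sim> t \<Longrightarrow> t \<sim> s"
  unfolding projective_def
  by (induction rule: tranclp.induct) (auto simp: symclp_def intro: tranclp_into_tranclp2)

lemma projective_trans: "r \<sim> s \<Longrightarrow> s \<sim> t \<Longrightarrow> r \<sim> t"
  unfolding projective_def by (rule tranclp_trans)

lemma perspective_up_imp_projective: "s \<nearrow> t \<Longrightarrow> s \<sim> t"
  unfolding projective_def by (auto intro!: tranclp.r_into_trancl simp: symclp_def)

lemma elements_Fg [simp]: "elements (Fg x) = {z. x \<le> z}"
  by (rule Fg.rep_eq)

lemma le_Fg_iff: "F \<le> Fg z \<longleftrightarrow> z \<in> elements F"
  using is_lattice_filter_upward[OF is_lattice_filter_elements[of F]]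
  by (auto simp: less_eq_lattice_filter.rep_eq)

lemma Fg_le_Fg_iff [simp]: "Fg x \<le> Fg y \<longleftrightarrow> x \<le> y"
  by (simp add: le_Fg_iff)

lemma Fg_sup: "Fg (x \<squnion> y) = Fg x \<squnion> Fg y"
  by (auto simp: elements_inject[symmetric] sup_lattice_filter.rep_eq)

lemma Fg_inf: "Fg (x \<sqinter> y) = Fg x \<sqinter> Fg y"
  by (auto simp: elements_inject[symmetric] inf_lattice_filter.rep_eq intro: order_trans inf_mono)

text \<open>\<open>Fg\<close> preserves meets and joins, hence single perspectivities in either
  direction; induction along the transitive closure does the rest.\<close>

lemma projective_Fg:
  assumes "(x, y) \<sim> (z, w)"
  shows "(Fg x, Fg y) \<sim> (Fg z, Fg w)"
proof -
  have step: "symclp (\<nearrow>) (map_prod Fg Fg s) (map_prod Fg Fg t)" if "symclp (\<nearrow>) s t" for s t :: "'a \<times> 'a"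
    using that by (cases s; cases t) (auto simp: symclp_def simp flip: Fg_sup Fg_inf)
  have "(symclp (\<nearrow>))\<^sup>+\<^sup>+ (map_prod Fg Fg s) (map_prod Fg Fg t)" if "(symclp (\<nearrow>))\<^sup>+\<^sup>+ s t" for s t :: "'a \<times> 'a"
    using that by induction (auto intro: step tranclp.intros)
  from this[of "(x, y)" "(z, w)"] assms show ?thesis
    by (simp add: projective_def)
qed

section \<open>Coverings under perspectivity\<close>

lemma covering_between: "x \<prec> y \<Longrightarrow> x \<le> z \<Longrightarrow> z \<le> y \<Longrightarrow> z = x \<or> z = y"
  unfolding covering_def by (metis order_le_less)

text \<open>Modularity recovers every \<open>t\<close> between \<open>z\<close> and \<open>w\<close>
  as \<open>z \<squnion> (y \<sqinter> t)\<close>, and the covering leaves only two values for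
  \<open>y \<sqinter> t\<close>.\<close>

lemma covering_perspective_up:
  fixes x y z w :: "'a::modular_lattice"
  assumes "x \<prec> y" and "(x, y) \<nearrow> (z, w)"
  shows "z \<prec> w"
proof -
  have yz: "y \<sqinter> z = x" "y \<squnion> z = w" "z \<le> w"
    using assms(2) by auto
  have "z \<noteq> w"
    using yz assms(1) unfolding covering_def by (metis inf_absorb1 order_less_irrefl sup_ge1)
  moreover have "t = z \<or> t = w" if "z \<le> t" "t \<le> w" for t
  proof -
    have "y \<sqinter> t = x \<or> y \<sqinter> t = y"
      by (rule covering_between[OF assms(1)]) (use yz that in \<open>auto intro: order_trans inf_mono\<close>)
    moreover have "t = z \<squnion> (y \<sqinter> t)"
      using modular_law[OF that(1), of y] yz that(2) by (simp add: sup_commute inf_absorb2)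
    moreover have "z \<squnion> x = z"
      using yz by (auto simp: sup_absorb1)
    ultimately show ?thesis
      using yz by (metis sup_commute)
  qed
  ultimately show ?thesis
    using yz(3) unfolding covering_def by (metis order_less_le)
qed

lemma covering_perspective_down:
  fixes x y z w :: "'a::modular_lattice"
  assumes "z \<prec> w" and "(x, y) \<nearrow> (z, w)"
  shows "x \<prec> y"
proof -
  have yz: "y \<sqinter> z = x" "y \<squnion> z = w" "x \<le> y"
    using assms(2) by auto
  have "x \<noteq> y"
    using yz assms(1) unfolding covering_def by (metis inf_le2 order_less_irrefl sup_absorb2)
  moreover have "t = x \<or> t = y" if "x \<le> t" "t \<le> y" for t
  proof -
    have "z \<squnion> t = z \<or> z \<squnion> t = w"
      by (rule covering_between[OF assms(1)]) (use yz that in \<open>auto intro: order_trans le_supI1 le_supI2\<close>)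
    moreover have "t = y \<sqinter> (z \<squnion> t)"
      using modular_law[OF that(2), of z] yz that(1) by (simp add: sup_commute inf_commute sup_absorb1)
    ultimately show ?thesis
      using yz by (metis inf_sup_absorb sup_commute)
  qed
  ultimately show ?thesis
    using yz(3) unfolding covering_def by (metis order_less_le)
qed

section \<open>Completely meet-irreducible elements\<close>

text \<open>In a complete lattice this makes \<open>p\<close> completely meet-irreducible with
  \<open>q\<close> its only upper cover. The gain over a covering is that any \<open>z\<close> not
  below \<open>p\<close> satisfies \<open>q \<le> p \<squnion> z\<close>.\<close>

definition least_above :: "'a::order \<Rightarrow> 'a \<Rightarrow> bool" where
  "least_above p q \<longleftrightarrow> p < q \<and> (\<forall>z. p < z \<longrightarrow> q \<le> z)"

lemma least_above_imp_covering: "least_above p q \<Longrightarrow> p \<prec> q"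
  by (auto simp: least_above_def covering_def)

lemma least_above_le_sup:
  fixes p q z :: "'a::lattice"
  shows "least_above p q \<Longrightarrow> \<not> z \<le> p \<Longrightarrow> q \<le> p \<squnion> z"
  unfolding least_above_def by (metis le_iff_sup less_le sup.commute sup_ge1)

lemma exists_least_above:
  fixes a b :: "'a::{modular_lattice, meet_continuous_lattice}"
  assumes "a \<prec> b"
  obtains p q where "least_above p q" "(a, b) \<nearrow> (p, q)"
proof -
  define Z where "Z = {z. a \<le> z \<and> b \<sqinter> z \<le> a}"
  have "\<exists>p\<in>Z. \<forall>z\<in>Z. p \<le> z \<longrightarrow> z = p"
  proof (rule predicate_Zorn)
    show "partial_order_on Z (relation_of (\<le>) Z)"
      by (rule partial_order_on_relation_ofI) auto
    fix K assume "K \<in> Chains (relation_of (\<le>) Z)"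
    then have K: "K \<subseteq> Z" "\<And>s t. s \<in> K \<Longrightarrow> t \<in> K \<Longrightarrow> s \<le> t \<or> t \<le> s"
      by (auto simp: Chains_def relation_of_def)
    show "\<exists>u\<in>Z. \<forall>z\<in>K. z \<le> u"
    proof (cases "K = {}")
      case True
      then show ?thesis by (auto simp: Z_def)
    next
      case False
      then have "up_directed K"
        using K(2) unfolding up_directed_def by (metis order_refl)
      \<comment> \<open>A nonempty chain is directed, so meet-continuity keeps its supremum in
        \<open>Z\<close>.\<close>
      then have "b \<sqinter> \<Squnion>K = (\<Squnion>z\<in>K. b \<sqinter> z)"
        by (rule meet_continuous)
      also have "\<dots> \<le> a"
        using K(1) by (auto simp: Z_def intro: SUP_least)
      finally have "b \<sqinter> \<Squnion>K \<le> a" .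
      moreover have "a \<le> \<Squnion>K"
        using False K(1) by (auto simp: Z_def intro: Sup_upper2)
      ultimately show ?thesis
        by (auto simp: Z_def intro: Sup_upper)
    qed
  qed
  then obtain p where p: "a \<le> p" "b \<sqinter> p \<le> a" and max: "\<And>z. z \<in> Z \<Longrightarrow> p \<le> z \<Longrightarrow> z = p"
    by (auto simp: Z_def)
  have ab: "a < b"
    using assms by (simp add: covering_def)
  have inf: "b \<sqinter> p = a"
    using p ab by (auto intro: antisym)
  \<comment> \<open>Maximality of \<open>p\<close> rules out \<open>b \<sqinter> z = a\<close>, so
    the covering leaves only \<open>b \<sqinter> z = b\<close>.\<close>
  have "b \<le> z" if "p < z" for z
  proof -
    have "b \<sqinter> z = a \<or> b \<sqinter> z = b"
      by (rule covering_between[OF assms]) (use that p ab in \<open>auto intro: order_trans\<close>)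
    moreover have "b \<sqinter> z \<noteq> a"
      using max[of z] that p(1) by (force simp: Z_def)
    ultimately show ?thesis
      by (simp add: le_iff_inf inf_commute)
  qed
  moreover have "p < b \<squnion> p"
    using inf ab by (metis inf.absorb1 less_le sup_ge2 sup_ge1)
  ultimately have "least_above p (b \<squnion> p)"
    by (auto simp: least_above_def)
  moreover have "(a, b) \<nearrow> (p, b \<squnion> p)"
    using inf ab by auto
  ultimately show ?thesis ..
qed

section \<open>Maximal chains of filters\<close>

lemma maxchain_linear:
  fixes C :: "'a::order set"
  assumes "pred_on.maxchain UNIV (\<le>) C" "s \<in> C" "t \<in> C"
  shows "s \<le> t \<or> t \<le> s"
  using pred_on.chain_total[OF pred_on.maxchain_imp_chain[OF assms(1)] assms(2,3)] by auto

lemma maxchain_memI: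
  fixes C :: "'a::order set"
  assumes C: "pred_on.maxchain UNIV (\<le>) C" and z: "\<And>c. c \<in> C \<Longrightarrow> c \<le> z \<or> z \<le> c"
  shows "z \<in> C"
proof (rule ccontr)
  assume "z \<notin> C"
  moreover have "pred_on.chain UNIV (\<le>) (insert z C)"
    using z maxchain_linear[OF C] unfolding pred_on.chain_def by auto
  ultimately show False
    using C unfolding pred_on.maxchain_def by blast
qed

text \<open>The chain is cut at \<open>Fg p\<close>, that is, by whether a filter contains
  \<open>p\<close>; the two sides of the cut turn out to be adjacent members of
  \<open>C\<close>.\<close>

lemma maxchain_covering_of_least_above:
  fixes p q :: "'a::{modular_lattice, bounded_lattice_top}"
  assumes C: "pred_on.maxchain UNIV (\<le>) C" and pq: "least_above p q"
  obtains u v where "u \<in> C" "v \<in> C" "u \<prec> v" "(u, v) \<nearrow> (Fg p, Fg q)"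
proof -
  note filter = is_lattice_filter_elements
  note up = is_lattice_filter_upward[OF filter]
  have top_mem: "top \<in> elements F" for F :: "'a lattice_filter"
    using is_lattice_filter_nonempty[OF filter] up by (metis top_greatest)
  have lin: "elements s \<subseteq> elements t \<or> elements t \<subseteq> elements s" if "s \<in> C" "t \<in> C" for s t
    using maxchain_linear[OF C that] by (auto simp: less_eq_lattice_filter.rep_eq)
  have p_less: "p < q" and q_least: "\<And>z. p < z \<Longrightarrow> q \<le> z"
    using pq by (auto simp: least_above_def)
  have p_top: "p \<noteq> top"
    using p_less by auto
  \<comment> \<open>In reverse inclusion \<open>U\<close> is the join of the lower side and
    \<open>V\<close>, a union along a chain of filters, is the meet of the upper side.\<close>
  define U where "U = (\<Inter>c\<in>{c\<in>C. p \<in> elements c}. elements c)"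
  define V where "V = (\<Union>c\<in>{c\<in>C. p \<notin> elements c}. elements c)"
  \<comment> \<open>The greatest filter belongs to \<open>C\<close> and omits \<open>p\<close>,
    which makes \<open>V\<close> nonempty.\<close>
  have "Fg top \<in> C"
    by (rule maxchain_memI[OF C]) (simp add: le_Fg_iff top_mem)
  then have "top \<in> V"
    using p_top by (auto simp: V_def top_unique intro!: bexI[of _ "Fg top"])
  have "is_lattice_filter V"
    using \<open>top \<in> V\<close>
  proof (rule is_lattice_filterI)
    show "s \<sqinter> t \<in> V" if "s \<in> V" "t \<in> V" for s t
    proof -
      obtain c d where "c \<in> C" "d \<in> C" "p \<notin> elements c" "p \<notin> elements d" "s \<in> elements c" "t \<in> elements d"
        using \<open>s \<in> V\<close> \<open>t \<in> V\<close> by (auto simp: V_def)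
      with lin[of c d] show ?thesis
        using is_lattice_filter_inf[OF filter] unfolding V_def by blast
    qed
  qed (auto simp: V_def intro: up)
  moreover have "is_lattice_filter U"
    by (rule is_lattice_filterI[of top])
      (auto simp: U_def top_mem intro: up is_lattice_filter_inf[OF filter])
  ultimately obtain u v where u: "elements u = U" and v: "elements v = V"
    by (metis Abs_lattice_filter_inverse mem_Collect_eq)
  have pu: "p \<in> elements u" and pv: "p \<notin> elements v"
    by (auto simp: u v U_def V_def)
  have le_u: "c \<le> u" if "c \<in> C" "p \<in> elements c" for c
    using that by (auto simp: less_eq_lattice_filter.rep_eq u U_def)
  have v_le: "v \<le> c" if "c \<in> C" "p \<notin> elements c" for c
    using that by (auto simp: less_eq_lattice_filter.rep_eq v V_def)
  have u_le: "u \<le> c" if "c \<in> C" "p \<notin> elements c" for c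
  proof -
    have "elements c \<subseteq> elements d" if "d \<in> C" "p \<in> elements d" for d
      using lin[OF \<open>c \<in> C\<close> \<open>d \<in> C\<close>] that \<open>p \<notin> elements c\<close> by auto
    then show ?thesis
      by (auto simp: less_eq_lattice_filter.rep_eq u U_def)
  qed
  have le_v: "c \<le> v" if "c \<in> C" "p \<in> elements c" for c
  proof -
    have "elements d \<subseteq> elements c" if "d \<in> C" "p \<notin> elements d" for d
      using lin[OF \<open>c \<in> C\<close> \<open>d \<in> C\<close>] that \<open>p \<in> elements c\<close> by auto
    then show ?thesis
      by (auto simp: less_eq_lattice_filter.rep_eq v V_def)
  qed
  have uC: "u \<in> C"
    by (rule maxchain_memI[OF C]) (use le_u u_le in blast)
  have vC: "v \<in> C"
    by (rule maxchain_memI[OF C]) (use le_v v_le in blast)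
  have "u < v"
    using u_le[OF vC pv] pu pv by (auto simp: order_less_le)
  moreover have "\<not> (u < z \<and> z < v)" for z
  proof
    assume z: "u < z \<and> z < v"
    have "z \<in> C"
      by (rule maxchain_memI[OF C]) (use z le_u v_le in \<open>metis order_trans less_imp_le\<close>)
    then show False
      using z le_u[of z] v_le[of z] by (meson leD)
  qed
  ultimately have uv: "u \<prec> v"
    by (auto simp: covering_def)
  have inf_u: "v \<sqinter> t = u" if "u \<le> t" "\<not> v \<le> t" for t
    using covering_between[OF uv, of "v \<sqinter> t"] that \<open>u < v\<close> by (metis inf_le1 inf_le2 le_inf_iff less_imp_le)
  have u_p: "u \<le> Fg p" and v_p: "\<not> v \<le> Fg p"
    using pu pv by (auto simp: le_Fg_iff)
  have "v \<le> Fg q"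
  proof (rule ccontr)
    assume "\<not> v \<le> Fg q"
    then have "v \<sqinter> Fg q = u"
      using u_p p_less by (intro inf_u) (auto simp: le_Fg_iff intro: up)
    \<comment> \<open>Membership of \<open>p\<close> yields \<open>f\<close> in \<open>v\<close>
      with \<open>f \<sqinter> q \<le> p\<close>. But \<open>f\<close> is not below
      \<open>p\<close>, so \<open>q \<le> p \<squnion> f\<close>, and modularity gives
      \<open>p \<squnion> (f \<sqinter> q) = q\<close>, a contradiction.\<close>
    then have "p \<in> elements (v \<sqinter> Fg q)"
      using pu by simp
    then obtain f where f: "f \<in> elements v" "f \<sqinter> q \<le> p"
      by (auto simp: inf_lattice_filter.rep_eq) (meson inf_mono order_refl order_trans)
    have "q \<le> p \<squnion> f"
      using f(1) pv up by (intro least_above_le_sup[OF pq]) blast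
    then have "p \<squnion> (f \<sqinter> q) = q"
      using modular_law[of p q f] p_less by (simp add: inf_absorb2)
    with f(2) p_less show False
      by (simp add: sup_absorb1)
  qed
  \<comment> \<open>Such a \<open>z\<close> lies above \<open>p\<close> and differs from it because
    \<open>p\<close> is not in \<open>v\<close>.\<close>
  moreover have "z \<in> elements (Fg q)" if "z \<in> elements (v \<squnion> Fg p)" for z
    using that pv q_least[of z] by (auto simp: sup_lattice_filter.rep_eq order_less_le)
  then have "Fg q \<le> v \<squnion> Fg p"
    by (auto simp: less_eq_lattice_filter.rep_eq)
  ultimately have "v \<squnion> Fg p = Fg q"
    using p_less by (intro antisym) auto
  then have "(u, v) \<nearrow> (Fg p, Fg q)"
    using inf_u[OF u_p v_p] \<open>u < v\<close> p_less by auto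
  with uC vC uv show ?thesis ..
qed

section \<open>One element serving finitely many perspectivities\<close>

lemma filter_finite_Inf:
  fixes h :: "'i \<Rightarrow> 'a::complete_lattice"
  assumes "finite J" "\<And>i. i \<in> J \<Longrightarrow> h i \<in> elements F"
  shows "(\<Sqinter>i\<in>J. h i) \<in> elements F"
  using assms
proof (induction J)
  case empty
  then show ?case
    using is_lattice_filter_nonempty[OF is_lattice_filter_elements]
      is_lattice_filter_upward[OF is_lattice_filter_elements] by (metis image_empty Inf_empty top_greatest)
qed (auto intro: is_lattice_filter_inf[OF is_lattice_filter_elements])

text \<open>All the meets \<open>v \<sqinter> Fg (p i)\<close> equal \<open>u\<close>, hence lie
  below every \<open>Fg (p j)\<close>. Each pair thus has its own witness in \<open>v\<close>, and
  finiteness of \<open>J\<close> keeps their meet in the filter.\<close>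

lemma common_perspectivity_witness:
  fixes p q :: "'i \<Rightarrow> 'a::complete_lattice"
  assumes J: "finite J" and persp: "\<And>i. i \<in> J \<Longrightarrow> (u, v) \<nearrow> (Fg (p i), Fg (q i))"
  obtains g where "g \<in> elements v" "\<And>i j. i \<in> J \<Longrightarrow> j \<in> J \<Longrightarrow> g \<sqinter> p i \<le> p j"
proof -
  have "\<exists>f\<in>elements v. f \<sqinter> p i \<le> p j" if "i \<in> J" "j \<in> J" for i j
  proof -
    have "v \<sqinter> Fg (p i) \<le> Fg (p j)"
      using persp[OF \<open>i \<in> J\<close>] persp[OF \<open>j \<in> J\<close>] by (metis inf_le2 perspective_up.simps)
    then show ?thesis
      by (auto simp: le_Fg_iff inf_lattice_filter.rep_eq) (meson inf_mono order_refl order_trans)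
  qed
  then obtain f where f: "\<And>i j. i \<in> J \<Longrightarrow> j \<in> J \<Longrightarrow> f i j \<in> elements v \<and> f i j \<sqinter> p i \<le> p j"
    by metis
  define g where "g = (\<Sqinter>(i, j)\<in>J \<times> J. f i j)"
  have "g \<in> elements v"
    unfolding g_def using J f by (intro filter_finite_Inf) auto
  moreover have "g \<sqinter> p i \<le> p j" if "i \<in> J" "j \<in> J" for i j
  proof -
    have "g \<le> f i j"
      unfolding g_def using that by (auto intro: INF_lower2[of "(i, j)"])
    then show ?thesis
      using f[OF that] by (meson inf_mono order_refl order_trans)
  qed
  ultimately show ?thesis ..
qed

section \<open>Growth of \<open>\<Lambda>\<close> and the pigeonhole count\<close>

lemma Lambda_le: "\<Lambda> n \<le> n"
proof (induction n rule: Lambda.induct)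
  case (2 m)
  then show ?case
    using floor_sqrt_le[of "Suc m"] by simp
qed simp

lemma Lambda_le_floor_sqrt: "\<Lambda> n \<le> floor_sqrt n"
proof (cases n)
  case (Suc m)
  have "floor_sqrt (Suc m) > 0"
    by simp
  then show ?thesis
    using Suc Lambda_le[of "floor_sqrt (Suc m) - 1"] by (simp del: floor_sqrt_greater_zero_iff)
qed simp

text \<open>With \<open>s\<close> the floor of the root, there are at most \<open>s\<close> values.
  Fibres of size at most \<open>s - 1\<close> would cover only \<open>s * (s - 1) < s * s\<close>
  indices.\<close>

lemma large_fiber:
  assumes "finite I" "0 < card I" "card (f ` I) < \<Lambda> (card I)"
  obtains t where "t \<in> f ` I" "floor_sqrt (card I) \<le> card {i\<in>I. f i = t}"
proof -
  define s where "s = floor_sqrt (card I)"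
  have "\<exists>t\<in>f ` I. s \<le> card {i\<in>I. f i = t}"
  proof (rule ccontr)
    assume "\<not> ?thesis"
    then have *: "card {i\<in>I. f i = t} \<le> s - 1" if "t \<in> f ` I" for t
      using that by force
    have "card I = (\<Sum>t\<in>f ` I. card {i\<in>I. f i = t})"
      using sum.image_gen[OF assms(1), of "\<lambda>_. 1" f] unfolding card_eq_sum .
    also have "\<dots> \<le> card (f ` I) * (s - 1)"
      using sum_bounded_above[OF *] by simp
    also have "\<dots> \<le> s * (s - 1)"
      using assms(3) Lambda_le_floor_sqrt[of "card I"] by (intro mult_right_mono) (auto simp: s_def)
    also have "\<dots> < s * s"
      using assms(2) by (simp add: s_def)
    also have "\<dots> \<le> card I"
      by (simp add: s_def flip: power2_eq_square)
    finally show False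
      by simp
  qed
  then show ?thesis
    using that by (auto simp: s_def)
qed

section \<open>Transporting coverings above the common witness\<close>

text \<open>The hypothesis \<open>g \<sqinter> p i \<le> p j\<close> is what keeps joining with \<open>g\<close> from collapsing the
  covering at \<open>k\<close>, but it needs an index below \<open>k\<close>; hence the least index is lost.\<close>

lemma coverings_above_witness:
  fixes a b p q :: "'i::linorder \<Rightarrow> 'a::{modular_lattice, complete_lattice}"
  assumes chain: "\<And>i j. i \<in> J \<Longrightarrow> j \<in> J \<Longrightarrow> i < j \<Longrightarrow> b j \<le> a i"
    and pq: "\<And>i. i \<in> J \<Longrightarrow> least_above (p i) (q i)"
    and persp: "\<And>i. i \<in> J \<Longrightarrow> (a i, b i) \<nearrow> (p i, q i)"
    and proj: "\<And>i. i \<in> J \<Longrightarrow> (x, y) \<sim> (a i, b i)"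
    and ne: "\<And>i. i \<in> J \<Longrightarrow> a i \<noteq> b i"
    and g: "\<And>i j. i \<in> J \<Longrightarrow> j \<in> J \<Longrightarrow> g \<sqinter> p i \<le> p j"
    and e: "\<And>i. i \<in> J \<Longrightarrow> e \<le> p i"
    and l: "l \<in> J"
  obtains A B where
    "\<And>k. k \<in> J \<Longrightarrow> l < k \<Longrightarrow> A k \<prec> B k"
    "\<And>k. k \<in> J \<Longrightarrow> l < k \<Longrightarrow> (x, y) \<sim> (A k, B k)"
    "\<And>k. k \<in> J \<Longrightarrow> l < k \<Longrightarrow> g \<le> A k"
    "\<And>k. k \<in> J \<Longrightarrow> l < k \<Longrightarrow> e \<le> A k"
    "\<And>j k. j \<in> J \<Longrightarrow> k \<in> J \<Longrightarrow> l < j \<Longrightarrow> j < k \<Longrightarrow> B k \<le> A j"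
proof -
  \<comment> \<open>Partial meets over strictly smaller indices, equal to top at the least index of
    \<open>J\<close>. Each covering is moved down from \<open>(p k, q k)\<close> to level
    \<open>S k\<close>, then up by joining with \<open>g\<close>.\<close>
  define S where "S k = (\<Sqinter>j\<in>{j\<in>J. j < k}. p j)" for k
  define A where "A k = (S k \<sqinter> p k) \<squnion> g" for k
  define B where "B k = (S k \<sqinter> q k) \<squnion> g" for k
  have p_le_q: "p k \<le> q k" if "k \<in> J" for k
    using pq[OF that] by (simp add: least_above_def less_imp_le)
  have lower: "(S k \<sqinter> p k, S k \<sqinter> q k) \<nearrow> (p k, q k)" if k: "k \<in> J" for k
  proof -
    \<comment> \<open>\<open>b k\<close> lies below all earlier \<open>p j\<close> but not below
      \<open>p k\<close>, so it separates \<open>S k\<close> from \<open>p k\<close>.\<close>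
    have "b k \<le> p j" if "j \<in> J" "j < k" for j
      using chain[OF that(1) k that(2)] persp[OF that(1)] by (metis inf_le2 order_trans perspective_up.simps)
    then have "b k \<le> S k"
      unfolding S_def by (blast intro: INF_greatest)
    moreover have "\<not> b k \<le> p k"
      using persp[OF k] ne[OF k] by (metis inf_absorb1 perspective_up.simps)
    ultimately have "\<not> S k \<le> p k"
      by (meson order_trans)
    then have "q k \<le> p k \<squnion> S k"
      by (rule least_above_le_sup[OF pq[OF k]])
    then have "p k \<squnion> (S k \<sqinter> q k) = q k"
      using modular_law[OF p_le_q[OF k], of "S k"] by (simp add: inf_absorb2)
    then show ?thesis
      using p_le_q[OF k] by (simp add: sup_commute inf_assoc inf_absorb2 le_infI2)
  qed
  have upper: "(S k \<sqinter> p k, S k \<sqinter> q k) \<nearrow> (A k, B k)" if k: "k \<in> J" "l < k" for k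
  proof -
    \<comment> \<open>Since \<open>l < k\<close>, \<open>p l\<close> is a factor of
      \<open>S k\<close>.\<close>
    have "g \<sqinter> S k \<le> g \<sqinter> p l"
      using l k(2) unfolding S_def by (intro inf_mono INF_lower) auto
    also have "\<dots> \<le> p k"
      by (rule g[OF l k(1)])
    finally have "g \<sqinter> (S k \<sqinter> q k) \<le> S k \<sqinter> p k"
      by (meson inf_le1 inf_le2 le_inf_iff order_trans)
    moreover have le: "S k \<sqinter> p k \<le> S k \<sqinter> q k"
      using p_le_q[OF k(1)] by (intro inf_mono) auto
    ultimately have "(S k \<sqinter> q k) \<sqinter> A k = S k \<sqinter> p k"
      using modular_law[OF le, of g] by (simp add: A_def inf_commute sup_absorb1)
    moreover have "(S k \<sqinter> q k) \<squnion> A k = B k"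
      using le by (simp add: A_def B_def sup_absorb1 flip: sup_assoc)
    moreover have "A k \<le> B k"
      using le by (auto simp: A_def B_def intro: le_supI1)
    ultimately show ?thesis
      using le by auto
  qed
  show ?thesis
  proof (rule that[of A B])
    fix k assume k: "k \<in> J" "l < k"
    show "A k \<prec> B k"
      by (rule covering_perspective_up[OF _ upper[OF k]])
        (rule covering_perspective_down[OF least_above_imp_covering[OF pq[OF k(1)]] lower[OF k(1)]])
    show "(x, y) \<sim> (A k, B k)"
      using proj[OF k(1)] persp[OF k(1)] lower[OF k(1)] upper[OF k]
      by (meson perspective_up_imp_projective projective_sym projective_trans)
    have "e \<le> S k \<sqinter> p k"
      using e k(1) unfolding S_def by (intro le_infI INF_greatest) auto
    then show "e \<le> A k"
      unfolding A_def by (rule le_supI1)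
    show "g \<le> A k"
      unfolding A_def by (rule sup_ge2)
  next
    show "B k \<le> A j" if "j \<in> J" "k \<in> J" "l < j" "j < k" for j k
    proof -
      \<comment> \<open>As \<open>j < k\<close>, the factors of \<open>S k\<close> include
        \<open>p j\<close> and all factors of \<open>S j\<close>.\<close>
      have "S k \<le> S j \<sqinter> p j"
        using that unfolding S_def by (intro le_infI INF_superset_mono INF_lower) auto
      then show ?thesis
        unfolding A_def B_def by (intro sup_mono le_infI1) auto
    qed
  qed
qed

section \<open>The induction on the number of coverings\<close>

text \<open>The lower bound \<open>e\<close> strengthens the induction: coverings not collapsed by
  joining with \<open>Fg e\<close> can be told apart from one that is. Any linearly ordered index
  type is allowed, so passing to a subset requires no renumbering.\<close>

lemma coverings_of_maxchain:
  fixes x y :: "'a::{modular_lattice, meet_continuous_lattice}" and a b :: "'i::linorder \<Rightarrow> 'a"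
  assumes C: "pred_on.maxchain UNIV (\<le>) C"
    and "finite I"
    and "\<And>i. i \<in> I \<Longrightarrow> a i \<prec> b i"
    and "\<And>i j. i \<in> I \<Longrightarrow> j \<in> I \<Longrightarrow> i < j \<Longrightarrow> b j \<le> a i"
    and "\<And>i. i \<in> I \<Longrightarrow> (x, y) \<sim> (a i, b i)"
    and "\<And>i. i \<in> I \<Longrightarrow> e \<le> a i"
  obtains T where "finite T" "\<Lambda> (card I) \<le> card T"
    "T \<subseteq> {(u, v). u \<in> C \<and> v \<in> C \<and> u \<prec> v \<and> (u, v) \<sim> (Fg x, Fg y)}"
    "\<And>u v. (u, v) \<in> T \<Longrightarrow> \<not> v \<le> u \<squnion> Fg e"
proof -
  define M where "M = {(u, v). u \<in> C \<and> v \<in> C \<and> u \<prec> v \<and> (u, v) \<sim> (Fg x, Fg y)}"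
  have "\<exists>T. finite T \<and> \<Lambda> (card I) \<le> card T \<and> T \<subseteq> M \<and> (\<forall>(u, v)\<in>T. \<not> v \<le> u \<squnion> Fg e)"
    using assms(2-)
  proof (induction "card I" arbitrary: I a b e rule: less_induct)
    case less
    note fin = \<open>finite I\<close> and cov = less.prems(2) and chain = less.prems(3)
      and proj = less.prems(4) and e_le = less.prems(5)
    have "\<exists>p q. least_above p q \<and> (a i, b i) \<nearrow> (p, q)" if "i \<in> I" for i
      using exists_least_above[OF cov[OF that]] by metis
    then obtain p q where pq: "\<And>i. i \<in> I \<Longrightarrow> least_above (p i) (q i)"
      and persp: "\<And>i. i \<in> I \<Longrightarrow> (a i, b i) \<nearrow> (p i, q i)"
      by metis
    have "\<exists>t. fst t \<in> C \<and> snd t \<in> C \<and> fst t \<prec> snd t \<and> (fst t, snd t) \<nearrow> (Fg (p i), Fg (q i))"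
      if "i \<in> I" for i
      using maxchain_covering_of_least_above[OF C pq[OF that]] by (metis fst_conv snd_conv)
    then obtain f where f: "\<And>i. i \<in> I \<Longrightarrow> fst (f i) \<in> C \<and> snd (f i) \<in> C \<and> fst (f i) \<prec> snd (f i)"
      and f_persp: "\<And>i. i \<in> I \<Longrightarrow> (fst (f i), snd (f i)) \<nearrow> (Fg (p i), Fg (q i))"
      by metis
    have f_proj: "f i \<sim> (Fg x, Fg y)" if "i \<in> I" for i
    proof -
      have "(x, y) \<sim> (p i, q i)"
        using proj[OF that] perspective_up_imp_projective[OF persp[OF that]] by (rule projective_trans)
      then show ?thesis
        using perspective_up_imp_projective[OF f_persp[OF that]]
        by (metis prod.collapse projective_Fg projective_sym projective_trans)
    qed
    have fM: "f ` I \<subseteq> M"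
      unfolding M_def case_prod_unfold using f f_proj by (simp add: image_subset_iff)
    have e_p: "e \<le> p i" if "i \<in> I" for i
      using e_le[OF that] persp[OF that] by (metis inf_le2 order_trans perspective_up.simps)
    \<comment> \<open>As \<open>e \<le> p i\<close>, a collapse would put \<open>snd (f i)\<close>
      below \<open>Fg (p i)\<close> and so identify \<open>Fg (p i)\<close> with
      \<open>Fg (q i)\<close>.\<close>
    have f_e: "\<not> snd (f i) \<le> fst (f i) \<squnion> Fg e" if "i \<in> I" for i
    proof
      assume "snd (f i) \<le> fst (f i) \<squnion> Fg e"
      also have "\<dots> \<le> Fg (p i)"
        using e_p[OF that] f_persp[OF that] by (metis Fg_le_Fg_iff inf_le2 le_supI perspective_up.simps)
      finally have "Fg (p i) = Fg (q i)"
        using f_persp[OF that] by (metis perspective_up.simps sup_absorb2)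
      then have "q i \<le> p i"
        by (metis Fg_le_Fg_iff order_refl)
      then show False
        using pq[OF that] by (auto simp: least_above_def)
    qed
    show ?case
    proof (cases "\<Lambda> (card I) \<le> card (f ` I)")
      case True
      then show ?thesis
        using fin fM f_e by (intro exI[of _ "f ` I"]) (auto simp: case_prod_beta)
    next
      case False
      then have less_Lambda: "card (f ` I) < \<Lambda> (card I)"
        by (simp only: not_le)
      then have "card I \<noteq> 0"
        by (intro notI) simp
      then have "0 < card I"
        by (simp only: neq0_conv)
      define s where "s = floor_sqrt (card I)"
      obtain t where t: "t \<in> f ` I" "s \<le> card {i\<in>I. f i = t}"
        by (rule large_fiber[OF fin \<open>0 < card I\<close> less_Lambda, folded s_def])
      \<comment> \<open>Trimming the fibre to exactly \<open>s\<close> indices leaves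
        \<open>s - 1\<close> without the least one, the argument in the recursion of
        \<open>\<Lambda>\<close>.\<close>
      then obtain J where J: "J \<subseteq> {i\<in>I. f i = t}" "card J = s"
        by (elim obtain_subset_with_card_n)
      have JI: "i \<in> I" and Jt: "f i = t" if "i \<in> J" for i
        using that J(1) by auto
      have finJ: "finite J"
        using fin JI by (meson finite_subset subsetI)
      have "0 < s"
        using \<open>0 < card I\<close> by (simp add: s_def)
      then have "J \<noteq> {}"
        using J(2) by auto
      have "(fst t, snd t) \<nearrow> (Fg (p i), Fg (q i))" if "i \<in> J" for i
        using f_persp[OF JI[OF that]] Jt[OF that] by simp
      then obtain g where g: "g \<in> elements (snd t)" "\<And>i j. i \<in> J \<Longrightarrow> j \<in> J \<Longrightarrow> g \<sqinter> p i \<le> p j"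
        using common_perspectivity_witness[OF finJ] by metis
      define l where "l = Min J"
      have l: "l \<in> J" "\<And>k. k \<in> J - {l} \<Longrightarrow> l < k"
        using Min_in[OF finJ \<open>J \<noteq> {}\<close>] Min_le[OF finJ] by (auto simp: l_def order_less_le)
      have ne: "a i \<noteq> b i" if "i \<in> J" for i
        using cov[OF JI[OF that]] by (auto simp: covering_def)
      obtain A B where AB:
        "\<And>k. k \<in> J \<Longrightarrow> l < k \<Longrightarrow> A k \<prec> B k"
        "\<And>k. k \<in> J \<Longrightarrow> l < k \<Longrightarrow> (x, y) \<sim> (A k, B k)"
        "\<And>k. k \<in> J \<Longrightarrow> l < k \<Longrightarrow> g \<le> A k"
        "\<And>k. k \<in> J \<Longrightarrow> l < k \<Longrightarrow> e \<le> A k"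
        "\<And>j k. j \<in> J \<Longrightarrow> k \<in> J \<Longrightarrow> l < j \<Longrightarrow> j < k \<Longrightarrow> B k \<le> A j"
        by (rule coverings_above_witness[of J b a p q x y g e l])
          (rule l(1) | (rule chain[OF JI JI] pq[OF JI] persp[OF JI] proj[OF JI] ne g(2) e_p[OF JI], assumption+) |
           (rule that, blast+))+
      have card': "card (J - {l}) = s - 1"
        using l(1) J(2) finJ by simp
      moreover have "s \<le> card I"
        by (simp add: s_def floor_sqrt_le)
      ultimately have card_less: "card (J - {l}) < card I"
        using \<open>0 < s\<close> by linarith
      \<comment> \<open>The bound grows from \<open>e\<close> to \<open>g \<squnion> e\<close>,
        below every \<open>A k\<close>.\<close>
      have "\<exists>T. finite T \<and> \<Lambda> (card (J - {l})) \<le> card T \<and> T \<subseteq> M \<and>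
          (\<forall>(u, v)\<in>T. \<not> v \<le> u \<squnion> Fg (g \<squnion> e))"
        by (rule less.hyps[OF card_less]) (use finJ l(2) in \<open>auto intro: AB\<close>)
      then obtain T where T: "finite T" "\<Lambda> (s - 1) \<le> card T" "T \<subseteq> M"
        "\<forall>(u, v)\<in>T. \<not> v \<le> u \<squnion> Fg (g \<squnion> e)"
        unfolding card' by blast
      \<comment> \<open>\<open>g\<close> belongs to \<open>snd t\<close>, so joining with
        \<open>Fg g\<close> collapses \<open>t\<close>, unlike the members of
        \<open>T\<close>.\<close>
      have "t \<notin> T"
      proof
        assume "t \<in> T"
        then have "\<not> snd t \<le> fst t \<squnion> Fg (g \<squnion> e)"
          using T(4) by (auto split: prod.splits)
        moreover have "snd t \<le> Fg g"
          using g(1) by (simp add: le_Fg_iff)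
        ultimately show False
          by (simp add: Fg_sup le_supI1 le_supI2)
      qed
      moreover have "\<Lambda> (card I) = 1 + \<Lambda> (s - 1)"
        using \<open>0 < card I\<close> unfolding s_def by (cases "card I") auto
      ultimately have "\<Lambda> (card I) \<le> card (insert t T)"
        using T by simp
      moreover have "\<not> v \<le> u \<squnion> Fg e" if "(u, v) \<in> T" for u v
      proof
        assume "v \<le> u \<squnion> Fg e"
        also have "\<dots> \<le> u \<squnion> Fg (g \<squnion> e)"
          by (intro sup_mono) auto
        finally show False
          using T(4) that by auto
      qed
      moreover have "\<not> snd t \<le> fst t \<squnion> Fg e" "t \<in> M"
        using t(1) f_e fM by auto
      ultimately show ?thesis
        using T by (intro exI[of _ "insert t T"]) auto
    qed
  qed
  then show ?thesis
    unfolding M_def by (elim exE conjE) (rule that, auto)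
qed

theorem theorem21:
  fixes x y :: "'a::{modular_lattice, meet_continuous_lattice}"
    and a b :: "nat \<Rightarrow> 'a"
    and n :: nat
    and C :: "'a lattice_filter set"
  assumes "x \<prec> y"
    and "\<forall>i\<in>{1..n}. a i \<prec> b i"
    and "\<forall>i\<in>{1..<n}. b (Suc i) \<le> a i"
    and "\<forall>i\<in>{1..n}. (x, y) \<sim> (a i, b i)"
    and "pred_on.maxchain UNIV (\<le>) C"
  shows "|{..<\<Lambda> n}| \<le>o \<mu> C (Fg x) (Fg y)"
proof -
  \<comment> \<open>The hypothesis links consecutive indices only; the induction needs all
    pairs.\<close>
  have chain: "b j \<le> a i" if "1 \<le> i" "i < j" "j \<le> n" for i j
    using that(2,3)
  proof (induction j)
    case (Suc j)
    show ?case
    proof (cases "i = j")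
      case True
      then show ?thesis
        using assms(3) that(1) Suc.prems by auto
    next
      case False
      then have "b (Suc j) \<le> a j" "a j \<prec> b j" "b j \<le> a i"
        using assms(2,3) that(1) Suc by auto
      then show ?thesis
        unfolding covering_def by (meson less_imp_le order_trans)
    qed
  qed simp
  \<comment> \<open>With \<open>e = bot\<close> the lower bound holds trivially. A finite
    \<open>T\<close> bounds the multiplicity from below even when that cardinal is infinite.\<close>
  obtain T where T: "finite T" "\<Lambda> (card {1..n}) \<le> card T"
    "T \<subseteq> {(u, v). u \<in> C \<and> v \<in> C \<and> u \<prec> v \<and> (u, v) \<sim> (Fg x, Fg y)}"
    by (rule coverings_of_maxchain[OF assms(5), of "{1..n}" a b x y bot])
      (use assms(2,4) chain in auto)
  have "|{..<\<Lambda> n}| \<le>o |T|"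
    using T(1,2) inj_on_iff_card_le[of "{..<\<Lambda> n}" T] by (simp flip: card_of_ordLeq)
  also have "|T| \<le>o \<mu> C (Fg x) (Fg y)"
    unfolding multiplicity_in_def by (rule card_of_mono1[OF T(3)])
  finally show ?thesis .
qed

end
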